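(* Consider a $\gamma$-symmetric random variable $X$. Let it be transformed using a function $\phi(x)$ such that $\phi^{(2)}(x)\ge0$ over the interval supported. Then the resulting convex transformed distribution is $\gamma$-ordered. Moreover, if the quantile function $Q$ of $X$ satisfies $Q^{(2)}(p)\le0$, then the convex transformed distribution is second $\gamma$-ordered.
   Context: Here $\gamma\ge0$, and distributions are by default continuous distributions on $\mathbb{R}$. A distribution is $\gamma$-symmetric if its quantile function $Q$ satisfies $Q(\gamma\epsilon)=2Q\left(\frac{\gamma}{1+\gamma}\right)-Q(1-\epsilon)$ for all $0\le\epsilon\le\frac1{1+\gamma}$. The convex transformed distribution is the distribution of the random variable $\phi(X)$. For any distribution, its quantile average is $\mathrm{QA}(\epsilon,\gamma)=\frac12\left(Q(\gamma\epsilon)+Q(1-\epsilon)\right)$, $0\le\epsilon\le\frac1{1+\gamma}$, where in this formula $Q$ denotes the quantile function of that distribution. In the default, right-skewed convention, a distribution is $\gamma$-ordered if $\mathrm{QA}(\epsilon_1,\gamma)\ge\mathrm{QA}(\epsilon_2,\gamma)$ for all $0\le\epsilon_1\le\epsilon_2\le\frac1{1+\gamma}$, also expressed as $\frac{\partial\mathrm{QA}}{\partial\epsilon}\le0$ for all $0\le\epsilon\le\frac1{1+\gamma}$. It is second $\gamma$-ordered if $\frac{\partial^2\mathrm{QA}}{\partial\epsilon^2}\ge0$ and $\frac{\partial\mathrm{QA}}{\partial\epsilon}\le0$ for all $0\le\epsilon\le\frac1{1+\gamma}$.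
   Formalization: φ is additionally assumed nondecreasing on the support interval (the claim fails otherwise, e.g. φ(x) = −x with γ = 2); in "second γ-ordered" the derivative conditions are required for 0 < ε ≤ 1/(1+γ), since at ε = 0 the quantile average may be infinite or undefined. *)

theory Defs
  imports "HOL-Probability.Probability"
begin

text \<open>
  Left-continuous quantile function, with values in the extended reals, since \<open>Q 0\<close> and \<open>Q 1\<close> are
  the end points of the support and may be infinite.  The usual infimum would give \<open>-\<infinity>\<close> at
  \<open>p = 0\<close> for every distribution, hence the separate clause.
\<close>

definition quantile :: "real measure \<Rightarrow> real \<Rightarrow> ereal" where
  "quantile D p =
     (if p = 0 then Sup {ereal x |x. cdf D x = 0} else Inf {ereal x |x. p \<le> cdf D x})"

definition support_interval :: "real measure \<Rightarrow> real set" where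
  "support_interval D = {x. quantile D 0 < ereal x \<and> ereal x < quantile D 1}"

definition quantile_average :: "real measure \<Rightarrow> real \<Rightarrow> real \<Rightarrow> ereal" where
  "quantile_average D \<epsilon> \<gamma> = (quantile D (\<gamma> * \<epsilon>) + quantile D (1 - \<epsilon>)) / 2"

definition gamma_symmetric :: "real measure \<Rightarrow> real \<Rightarrow> bool" where
  "gamma_symmetric D \<gamma> \<longleftrightarrow>
     (\<forall>\<epsilon>. 0 \<le> \<epsilon> \<and> \<epsilon> \<le> 1 / (1 + \<gamma>) \<longrightarrow>
        quantile D (\<gamma> * \<epsilon>) = 2 * quantile D (\<gamma> / (1 + \<gamma>)) - quantile D (1 - \<epsilon>))"

text \<open>
  If the support is unbounded on both sides, the quantile average at \<open>\<epsilon> = 0\<close> is \<open>-\<infinity> + \<infinity>\<close>, which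
  is \<open>\<infinity>\<close> in type \<^typ>\<open>ereal\<close>; the condition below is then vacuous at \<open>\<epsilon>\<^sub>1 = 0\<close>.
\<close>

definition gamma_ordered :: "real measure \<Rightarrow> real \<Rightarrow> bool" where
  "gamma_ordered D \<gamma> \<longleftrightarrow>
     (\<forall>\<epsilon>\<^sub>1 \<epsilon>\<^sub>2. 0 \<le> \<epsilon>\<^sub>1 \<and> \<epsilon>\<^sub>1 \<le> \<epsilon>\<^sub>2 \<and> \<epsilon>\<^sub>2 \<le> 1 / (1 + \<gamma>) \<longrightarrow>
        quantile_average D \<epsilon>\<^sub>1 \<gamma> \<ge> quantile_average D \<epsilon>\<^sub>2 \<gamma>)"

text \<open>Derivatives are relative to \<open>S\<close>, that is, one-sided at an end point belonging to \<open>S\<close>.\<close>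

definition has_two_derivs_on ::
    "(real \<Rightarrow> real) \<Rightarrow> (real \<Rightarrow> real) \<Rightarrow> (real \<Rightarrow> real) \<Rightarrow> real set \<Rightarrow> bool" where
  "has_two_derivs_on f f' f'' S \<longleftrightarrow>
     (\<forall>x\<in>S. (f has_real_derivative f' x) (at x within S) \<and>
             (f' has_real_derivative f'' x) (at x within S))"

text \<open>
  At \<open>\<epsilon> = 0\<close> the quantiles at \<open>0\<close> and \<open>1\<close> enter, where neither the quantile average nor its
  derivatives need be finite; there only monotonicity is required, by \<^const>\<open>gamma_ordered\<close>.
  If the one-sided derivatives at \<open>0\<close> exist, they inherit their signs from the rest of the interval.
\<close>

definition second_gamma_ordered :: "real measure \<Rightarrow> real \<Rightarrow> bool" where
  "second_gamma_ordered D \<gamma> \<longleftrightarrow>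
     gamma_ordered D \<gamma> \<and>
     (\<forall>\<epsilon>\<in>{0<..1 / (1 + \<gamma>)}. \<bar>quantile_average D \<epsilon> \<gamma>\<bar> \<noteq> \<infinity>) \<and>
     (\<exists>A' A''.
        has_two_derivs_on (\<lambda>\<epsilon>. real_of_ereal (quantile_average D \<epsilon> \<gamma>)) A' A'' {0<..1 / (1 + \<gamma>)} \<and>
        (\<forall>\<epsilon>\<in>{0<..1 / (1 + \<gamma>)}. A'' \<epsilon> \<ge> 0 \<and> A' \<epsilon> \<le> 0))"

end

theory Submission
  imports Defs
begin

text \<open>
  Let \<open>Q\<close> be the quantile function of \<open>X\<close>, \<open>m = Q (\<gamma> / (1 + \<gamma>))\<close> and \<open>u \<epsilon> = Q (\<gamma> * \<epsilon>) \<le> m\<close>.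
  Since \<open>\<phi>\<close> is monotone and continuous on the support, it commutes with quantiles at levels
  strictly between \<open>0\<close> and \<open>1\<close> (\<open>quantile_transform\<close>).  Symmetry of \<open>X\<close> says
  \<open>Q (1 - \<epsilon>) = 2 * m - u \<epsilon>\<close>, so for \<open>\<epsilon> > 0\<close> the quantile average of \<open>\<phi> (X)\<close> is
  \<open>A \<epsilon> = (\<phi> (u \<epsilon>) + \<phi> (2 * m - u \<epsilon>)) / 2\<close>.
  As \<open>\<epsilon>\<close> grows, the two arguments move towards their fixed midpoint \<open>m\<close>, and convexity of \<open>\<phi>\<close> makes
  \<open>A\<close> decrease (\<open>convex_on_spread\<close>).

  At \<open>\<epsilon> = 0\<close> the quantiles of \<open>\<phi> (X)\<close> may be infinite.  There \<open>Q\<^sub>\<phi> 1\<close> bounds every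
  \<open>\<phi> (2 * m - u \<delta>)\<close> from above, hence \<open>\<phi> (u \<delta>) \<ge> 2 * A \<epsilon> - Q\<^sub>\<phi> 1\<close> for all small
  \<open>\<delta>\<close>; a lower bound for all quantiles near level \<open>0\<close> is a lower bound for \<open>Q\<^sub>\<phi> 0\<close>
  (\<open>quantile_zero_ge\<close>), and so \<open>Q\<^sub>\<phi> 0 + Q\<^sub>\<phi> 1 \<ge> 2 * A \<epsilon>\<close>.

  If \<open>Q\<close> is twice differentiable, then with \<open>v = 2 * m - u\<close> the chain rule gives, up to positive
  factors, \<open>Q' * (\<phi>' u - \<phi>' v)\<close> as first derivative of \<open>A\<close> and
  \<open>Q'' * (\<phi>' u - \<phi>' v) + Q'\<^sup>2 * (\<phi>'' u + \<phi>'' v)\<close> as second.  The signs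
  follow from \<open>u \<le> v\<close>, monotonicity of \<open>\<phi>'\<close>, \<open>Q' \<ge> 0\<close>, \<open>Q'' \<le> 0\<close> and \<open>\<phi>'' \<ge> 0\<close>.
\<close>

section \<open>Quantile functions\<close>

text \<open>
  Right-continuity of the distribution function makes the infimum in the quantile a minimum.
\<close>

lemma quantile_le_iff:
  assumes "real_distribution D" and "0 < p"
  shows "quantile D p \<le> ereal y \<longleftrightarrow> p \<le> cdf D y"
proof
  interpret real_distribution D by fact
  have q: "quantile D p = Inf {ereal x |x. p \<le> cdf D x}"
    using assms(2) by (simp add: quantile_def)
  show "p \<le> cdf D y \<Longrightarrow> quantile D p \<le> ereal y"
    unfolding q by (rule Inf_lower) auto
  assume le: "quantile D p \<le> ereal y"
  have "p \<le> cdf D z" if "y < z" for z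
  proof -
    have "quantile D p < ereal z"
      using le that by (metis less_ereal.simps(1) le_less_trans)
    then obtain x where "p \<le> cdf D x" "x < z"
      unfolding q Inf_less_iff by auto
    then show ?thesis
      using cdf_nondecreasing[of x z] by simp
  qed
  then have "eventually (\<lambda>z. p \<le> cdf D z) (at_right y)"
    by (intro eventually_at_rightI[of y "y + 1"]) auto
  moreover have "(cdf D \<longlongrightarrow> cdf D y) (at_right y)"
    using cdf_is_right_cont[of y] by (simp add: continuous_within)
  ultimately show "p \<le> cdf D y"
    by (intro tendsto_lowerbound[of "cdf D" _ "at_right y"]) auto
qed

lemma quantile_mono:
  assumes "0 < p" and "p \<le> p'"
  shows "quantile D p \<le> quantile D p'"
  using assms by (auto simp: quantile_def intro!: Inf_superset_mono)

text \<open>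
  The level \<open>0\<close> has its own clause in the definition of the quantile; this is how bounds at small
  positive levels pass to it.  If \<open>cdf D y\<close> were positive for some \<open>y < r\<close>, quantiles at positive
  levels up to \<open>cdf D y\<close> would be at most \<open>y\<close>.
\<close>

lemma quantile_zero_ge:
  assumes D: "real_distribution D" and "0 < \<delta>"
    and ge: "\<And>p. 0 < p \<Longrightarrow> p < \<delta> \<Longrightarrow> ereal r \<le> quantile D p"
  shows "ereal r \<le> quantile D 0"
proof -
  interpret real_distribution D by fact
  have "cdf D y = 0" if "y < r" for y
  proof (rule ccontr)
    assume "cdf D y \<noteq> 0"
    with cdf_nonneg[of y] have "0 < cdf D y" by simp
    define p where "p = min (cdf D y) (\<delta> / 2)"
    have p: "0 < p" "p < \<delta>" "p \<le> cdf D y"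
      using \<open>0 < cdf D y\<close> \<open>0 < \<delta>\<close> by (auto simp: p_def)
    then have "quantile D p \<le> ereal y"
      by (simp add: quantile_le_iff[OF D])
    with ge[OF p(1,2)] have "ereal r \<le> ereal y" by (rule order_trans)
    with that show False by simp
  qed
  then have "ereal y \<le> quantile D 0" if "y < r" for y
    using that by (auto simp: quantile_def intro!: Sup_upper)
  then show ?thesis
    by (metis ereal_dense2 leD leI less_ereal.simps(1))
qed

text \<open>
  Without atoms, the quantile is a right inverse of the distribution function.  Levels strictly
  between \<open>0\<close> and \<open>1\<close> are then attained strictly inside the support, which is where the
  transformation is known to be smooth, convex and monotone.
\<close>

lemma cdf_quantile:
  assumes D: "real_distribution D" and cont: "continuous_on UNIV (cdf D)"
    and p: "0 < p" "p < 1"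
  obtains x where "quantile D p = ereal x" "cdf D x = p" "x \<in> support_interval D"
proof -
  interpret real_distribution D by fact
  have ic: "isCont (cdf D) x" for x
    using cont by (simp add: continuous_on_eq_continuous_at)
  obtain a where a: "cdf D a < p"
    using order_tendstoD(2)[OF cdf_lim_at_bot p(1)] eventually_happens trivial_limit_at_bot_linorder
    by blast
  obtain b where b: "p < cdf D b"
    using order_tendstoD(1)[OF cdf_lim_at_top_prob p(2)] eventually_happens trivial_limit_at_top_linorder
    by blast
  have "\<not> quantile D p \<le> ereal a" "quantile D p \<le> ereal b"
    using a b p by (simp_all add: quantile_le_iff[OF D])
  then obtain x where x: "quantile D p = ereal x"
    by (cases "quantile D p") auto
  have iff: "x \<le> y \<longleftrightarrow> p \<le> cdf D y" for y
    using quantile_le_iff[OF D p(1), of y] by (simp add: x)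
  have "cdf D z \<le> p" if "z < x" for z
    using iff[of z] that by simp
  then have "eventually (\<lambda>z. cdf D z \<le> p) (at_left x)"
    by (simp add: eventually_at_filter)
  moreover have lim: "(cdf D \<longlongrightarrow> cdf D x) (at_left x)"
    using ic[of x] by (simp add: isCont_def filterlim_at_split)
  ultimately have "cdf D x \<le> p"
    by (intro tendsto_upperbound[of "cdf D" _ "at_left x"]) auto
  then have Fx: "cdf D x = p" using iff[of x] by simp
  have "eventually (\<lambda>z. 0 < cdf D z \<and> z < x) (at_left x)"
    using order_tendstoD(1)[OF lim, of 0] p(1) Fx
    by (auto intro: eventually_conj simp: eventually_at_left_real eventually_at_filter)
  then obtain z where z: "0 < cdf D z" "z < x"
    using eventually_happens trivial_limit_at_left_real by blast
  have "quantile D 0 \<le> ereal z"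
    using z(1) cdf_nondecreasing[of z]
    by (auto simp: quantile_def intro!: Sup_least) (metis less_le_not_le linorder_le_cases)
  also have "ereal z < ereal x" using z by simp
  finally have "quantile D 0 < ereal x" .
  moreover have "ereal x < quantile D 1"
    using p(2) Fx quantile_le_iff[OF D, of 1 x] by simp
  ultimately show ?thesis
    using x Fx by (intro that) (auto simp: support_interval_def)
qed

lemma open_support_interval: "open (support_interval D)"
proof -
  have "support_interval D = ereal -` {quantile D 0<..<quantile D 1}"
    by (auto simp: support_interval_def)
  moreover have "open \<dots>"
    by (intro open_vimage open_greaterThanLessThan continuous_on_ereal continuous_on_id)
  ultimately show ?thesis by simp
qed

lemma support_interval_between:
  assumes "a \<in> support_interval D" "b \<in> support_interval D" "a \<le> x" "x \<le> b"
  shows "x \<in> support_interval D"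
  using assms unfolding support_interval_def
  by simp (meson ereal_less_eq(3) less_le_trans le_less_trans)

lemma convex_support_interval: "convex (support_interval D)"
  by (meson is_interval_1 is_interval_convex support_interval_between)

section \<open>Quantiles of a monotone transform\<close>

lemma cdf_distr_real:
  assumes "X \<in> borel_measurable M"
  shows "cdf (distr M borel X) x = measure M {\<omega> \<in> space M. X \<omega> \<le> x}"
  unfolding cdf_def using assms
  by (subst measure_distr) (auto intro!: arg_cong[of _ _ "measure M"])

text \<open>
  \<open>\<phi>\<close> is controlled on the open support only, and no value at the end points is available.
  Probabilities are therefore bounded through the sets \<open>{a < X \<le> b}\<close> with \<open>a\<close> and \<open>b\<close> interior
  quantiles, whose levels tend to those of the end points.
\<close>

lemma quantile_transform:
  fixes M :: "'a measure" and X :: "'a \<Rightarrow> real"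
  assumes "prob_space M" and X: "X \<in> borel_measurable M"
    and Y: "(\<lambda>\<omega>. \<phi> (X \<omega>)) \<in> borel_measurable M"
    and cont: "continuous_on UNIV (cdf (distr M borel X))"
    and mono: "mono_on (support_interval (distr M borel X)) \<phi>"
    and cont_phi: "continuous_on (support_interval (distr M borel X)) \<phi>"
    and p: "0 < p" "p < 1"
    and q: "quantile (distr M borel X) p = ereal q"
  shows "quantile (distr M borel (\<lambda>\<omega>. \<phi> (X \<omega>))) p = ereal (\<phi> q)"
proof -
  interpret prob_space M by fact
  let ?D = "distr M borel X" and ?E = "distr M borel (\<lambda>\<omega>. \<phi> (X \<omega>))"
  let ?S = "support_interval ?D"
  have D: "real_distribution ?D" and E: "real_distribution ?E"
    using X Y by (auto intro: real_distribution_distr)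
  have Fq: "cdf ?D q = p" and qS: "q \<in> ?S"
    using cdf_quantile[OF D cont p] q by auto
  note FX = cdf_distr_real[OF X] and FY = cdf_distr_real[OF Y]
  note [measurable] = X Y
  have PIoc: "prob {\<omega> \<in> space M. a < X \<omega> \<and> X \<omega> \<le> b} = cdf ?D b - cdf ?D a" if "a \<le> b" for a b
  proof -
    have "{\<omega> \<in> space M. a < X \<omega> \<and> X \<omega> \<le> b} =
        {\<omega> \<in> space M. X \<omega> \<le> b} - {\<omega> \<in> space M. X \<omega> \<le> a}" by auto
    moreover have "prob ({\<omega> \<in> space M. X \<omega> \<le> b} - {\<omega> \<in> space M. X \<omega> \<le> a}) =
        prob {\<omega> \<in> space M. X \<omega> \<le> b} - prob {\<omega> \<in> space M. X \<omega> \<le> a}"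
      using that by (intro finite_measure_Diff) auto
    ultimately show ?thesis
      by (simp add: FX)
  qed
  have "p \<le> cdf ?E y \<longleftrightarrow> \<phi> q \<le> y" for y
  proof
    assume le: "\<phi> q \<le> y"
    have bound: "p \<le> cdf ?E y + s" if s: "0 < s" "s < p" for s
    proof -
      have "s < 1" using s p by simp
      obtain a where a: "cdf ?D a = s" "a \<in> ?S" "quantile ?D s = ereal a"
        using cdf_quantile[OF D cont s(1) \<open>s < 1\<close>] by metis
      have "a \<le> q" using quantile_mono[of s p ?D] s q a by simp
      have "{\<omega> \<in> space M. a < X \<omega> \<and> X \<omega> \<le> q} \<subseteq> {\<omega> \<in> space M. \<phi> (X \<omega>) \<le> y}"
      proof clarsimp
        fix \<omega> assume "a < X \<omega>" "X \<omega> \<le> q"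
        then have "\<phi> (X \<omega>) \<le> \<phi> q"
          using mono_onD[OF mono support_interval_between[OF a(2) qS] qS] by simp
        with le show "\<phi> (X \<omega>) \<le> y" by simp
      qed
      then have "p - s \<le> cdf ?E y"
        unfolding FY PIoc[OF \<open>a \<le> q\<close>, unfolded Fq a(1), symmetric]
        by (intro finite_measure_mono) auto
      then show ?thesis by simp
    qed
    show "p \<le> cdf ?E y"
    proof (rule field_le_epsilon)
      fix e :: real assume "0 < e"
      then have "p \<le> cdf ?E y + min e (p / 2)"
        using p(1) by (intro bound) (auto simp: min_def)
      then show "p \<le> cdf ?E y + e" by linarith
    qed
  next
    assume le: "p \<le> cdf ?E y"
    show "\<phi> q \<le> y"
    proof (rule ccontr)
      assume "\<not> \<phi> q \<le> y"
      then have "y < \<phi> q" by simp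
      moreover have "isCont \<phi> q"
        using cont_phi qS open_support_interval continuous_on_eq_continuous_at by blast
      ultimately have "eventually (\<lambda>x. y < \<phi> x) (at_left q)"
        by (auto simp: isCont_def filterlim_at_split intro: order_tendstoD)
      moreover have "eventually (\<lambda>x. x \<in> ?S) (at_left q)"
        using eventually_at_in_open'[OF open_support_interval qS] by (simp add: eventually_at_split)
      moreover have "eventually (\<lambda>x. x < q) (at_left q)"
        by (simp add: eventually_at_filter)
      ultimately have "eventually (\<lambda>x. y < \<phi> x \<and> x \<in> ?S \<and> x < q) (at_left q)"
        by (intro eventually_conj)
      then obtain x where x: "y < \<phi> x" "x \<in> ?S" "x < q"
        using eventually_happens trivial_limit_at_left_real by blast
      have Fx: "cdf ?D x < p"
        using quantile_le_iff[OF D p(1), of x] q x(3) by simp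
      have "cdf ?E y \<le> cdf ?D x + (1 - t)" if t: "p < t" "t < 1" for t
      proof -
        have "0 < t" using p t by simp
        obtain b where b: "cdf ?D b = t" "b \<in> ?S" "quantile ?D t = ereal b"
          using cdf_quantile[OF D cont \<open>0 < t\<close> t(2)] by metis
        have "x \<le> b" using quantile_mono[of p t ?D] t q p b x by simp
        have "{\<omega> \<in> space M. x < X \<omega> \<and> X \<omega> \<le> b} \<subseteq> {\<omega> \<in> space M. y < \<phi> (X \<omega>)}"
        proof clarsimp
          fix \<omega> assume "x < X \<omega>" "X \<omega> \<le> b"
          then have "\<phi> x \<le> \<phi> (X \<omega>)"
            using mono_onD[OF mono x(2) support_interval_between[OF x(2) b(2)]] by simp
          with x show "y < \<phi> (X \<omega>)" by simp
        qed
        then have "prob {\<omega> \<in> space M. x < X \<omega> \<and> X \<omega> \<le> b} \<le> prob {\<omega> \<in> space M. y < \<phi> (X \<omega>)}"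
          by (intro finite_measure_mono) auto
        moreover have "prob {\<omega> \<in> space M. y < \<phi> (X \<omega>)} = 1 - cdf ?E y"
          unfolding FY by (subst prob_neg[symmetric]) (auto simp: not_le)
        ultimately show ?thesis
          using PIoc[OF \<open>x \<le> b\<close>] b(1) by simp
      qed
      moreover obtain t where "max p (1 - (p - cdf ?D x)) < t" "t < 1"
        using dense[of "max p (1 - (p - cdf ?D x))" 1] p Fx by auto
      ultimately have "cdf ?E y < p" by force
      with le show False by simp
    qed
  qed
  then have iff: "quantile ?E p \<le> ereal y \<longleftrightarrow> \<phi> q \<le> y" for y
    by (simp add: quantile_le_iff[OF E p(1)])
  obtain r where r: "quantile ?E p = ereal r"
    using iff[of "\<phi> q"] iff[of "\<phi> q - 1"] by (cases "quantile ?E p") auto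
  show ?thesis
    using iff[of "\<phi> q"] iff[of r] by (simp add: r)
qed

section \<open>Convexity and monotonicity\<close>

text \<open>
  Two points with a given midpoint: both inner points are convex combinations of the outer ones,
  with exchanged weights.
\<close>

lemma convex_on_spread:
  fixes f :: "real \<Rightarrow> real"
  assumes f: "convex_on S f" and S: "a' \<in> S" "b' \<in> S"
    and ord: "a' \<le> a" "a \<le> b'" and sum: "a + b = a' + b'"
  shows "f a + f b \<le> f a' + f b'"
proof (cases "a' = b'")
  case True
  with ord sum show ?thesis by simp
next
  case False
  define u where "u = (b' - a) / (b' - a')"
  have u: "0 \<le> u" "u \<le> 1" and d: "b' - a' > 0"
    using False ord by (auto simp: u_def field_simps)
  have a: "a = u * a' + (1 - u) * b'"
  proof -
    have "u * (b' - a') = b' - a" using d by (simp add: u_def)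
    then show ?thesis by (simp add: algebra_simps)
  qed
  then have b: "b = (1 - u) * a' + u * b'"
    using sum by (simp add: algebra_simps)
  have "f a \<le> u * f a' + (1 - u) * f b'"
    using convex_onD[OF f, of "1 - u" a' b'] u S a by simp
  moreover have "f b \<le> (1 - u) * f a' + u * f b'"
    using convex_onD[OF f, of u a' b'] u S b by simp
  ultimately show ?thesis by (simp add: algebra_simps)
qed

text \<open>A version that also covers one-sided derivatives at an end point of \<open>S\<close>.\<close>

lemma mono_on_deriv_within_nonneg:
  fixes f :: "real \<Rightarrow> real"
  assumes "mono_on S f" and "(f has_real_derivative d) (at x within S)"
    and "x \<in> S" and "at x within S \<noteq> bot"
  shows "0 \<le> d"
proof (rule tendsto_lowerbound)
  show "((\<lambda>y. (f y - f x) / (y - x)) \<longlongrightarrow> d) (at x within S)"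
    using assms(2) by (simp add: has_field_derivative_iff)
  show "eventually (\<lambda>y. 0 \<le> (f y - f x) / (y - x)) (at x within S)"
    unfolding eventually_at_filter
  proof (intro always_eventually allI impI)
    fix y assume "y \<noteq> x" "y \<in> S"
    then show "0 \<le> (f y - f x) / (y - x)"
      using mono_onD[OF assms(1) assms(3), of y] mono_onD[OF assms(1) _ assms(3), of y]
      by (cases "x \<le> y") (auto simp: divide_nonpos_nonpos)
  qed
qed (use assms in simp)

section \<open>Ordering of the transformed distribution\<close>

text \<open>
  For \<open>\<gamma> = 0\<close> symmetry would force the quantiles at \<open>1/2\<close> and \<open>1/4\<close> to coincide with a finite \<open>Q 0\<close>; a quantile
  \<open>Q 0 = -\<infinity>\<close> is excluded at \<open>\<epsilon> = 1\<close>, where the right-hand side is \<open>-\<infinity> - (-\<infinity>) = \<infinity>\<close>.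
\<close>

lemma gamma_symmetric_pos:
  assumes D: "real_distribution D" and cont: "continuous_on UNIV (cdf D)"
    and sym: "gamma_symmetric D \<gamma>" and "0 \<le> \<gamma>"
  shows "0 < \<gamma>"
proof (rule ccontr)
  assume "\<not> 0 < \<gamma>"
  with \<open>0 \<le> \<gamma>\<close> have 0: "\<gamma> = 0" by simp
  obtain x where x: "quantile D (1/2) = ereal x" "cdf D x = 1/2" "x \<in> support_interval D"
    using cdf_quantile[OF D cont, of "1/2"] by auto
  obtain y where y: "quantile D (1/4) = ereal y" "cdf D y = 1/4"
    using cdf_quantile[OF D cont, of "1/4"] by auto
  have S: "quantile D 0 = 2 * quantile D 0 - quantile D (1 - \<epsilon>)" if "0 \<le> \<epsilon>" "\<epsilon> \<le> 1" for \<epsilon>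
    using sym that unfolding gamma_symmetric_def 0 by simp
  have "quantile D 0 < ereal x" using x(3) by (simp add: support_interval_def)
  then show False
    using S[of 1] S[of "1/2"] S[of "3/4"] x y by (cases "quantile D 0") auto
qed

theorem mainTheorem7:
  fixes M :: "'a measure" and X :: "'a \<Rightarrow> real" and \<gamma> :: real
    and \<phi> \<phi>' \<phi>'' :: "real \<Rightarrow> real"
  assumes "prob_space M"
    and "X \<in> borel_measurable M"
    and "\<gamma> \<ge> 0"
    and "continuous_on UNIV (cdf (distr M borel X))"
    and "gamma_symmetric (distr M borel X) \<gamma>"
    and "(\<lambda>\<omega>. \<phi> (X \<omega>)) \<in> borel_measurable M"
    and "has_two_derivs_on \<phi> \<phi>' \<phi>'' (support_interval (distr M borel X))"
    and "\<forall>x\<in>support_interval (distr M borel X). \<phi>'' x \<ge> 0"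
    and "mono_on (support_interval (distr M borel X)) \<phi>"
  shows "gamma_ordered (distr M borel (\<lambda>\<omega>. \<phi> (X \<omega>))) \<gamma> \<and>
    ((\<exists>Q' Q''.
        has_two_derivs_on (\<lambda>p. real_of_ereal (quantile (distr M borel X) p)) Q' Q''
          {0<..\<gamma> / (1 + \<gamma>)} \<and>
        (\<forall>p\<in>{0<..\<gamma> / (1 + \<gamma>)}. Q'' p \<le> 0))
      \<longrightarrow> second_gamma_ordered (distr M borel (\<lambda>\<omega>. \<phi> (X \<omega>))) \<gamma>)"
proof -
  let ?D = "distr M borel X" and ?E = "distr M borel (\<lambda>\<omega>. \<phi> (X \<omega>))"
  let ?S = "support_interval ?D"
  define c where "c = \<gamma> / (1 + \<gamma>)"
  define N where "N = 1 / (1 + \<gamma>)"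
  note cont = assms(4) and sym = assms(5) and mono = assms(9)
  interpret prob_space M by fact
  have D: "real_distribution ?D" and E: "real_distribution ?E"
    using assms(2,6) by (auto intro: real_distribution_distr)
  have \<gamma>: "0 < \<gamma>" using gamma_symmetric_pos[OF D cont sym assms(3)] .
  have cN: "0 < c" "c < 1" "0 < N" "N < 1" "\<gamma> * N = c" "1 - N = c"
    unfolding c_def N_def using \<gamma> by (simp_all add: divide_simps)
  have range: "0 < \<gamma> * \<epsilon>" "\<gamma> * \<epsilon> \<le> c" "c \<le> 1 - \<epsilon>" "1 - \<epsilon> < 1"
    if "0 < \<epsilon>" "\<epsilon> \<le> N" for \<epsilon>
    using that \<gamma> cN(6) mult_left_mono[of \<epsilon> N \<gamma>] unfolding cN(5) by simp_all

  have d\<phi>: "(\<phi> has_real_derivative \<phi>' x) (at x)" "(\<phi>' has_real_derivative \<phi>'' x) (at x)"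
    if "x \<in> ?S" for x
    using assms(7) that unfolding has_two_derivs_on_def
    by (metis at_within_open open_support_interval)+
  have conv: "convex_on ?S \<phi>"
    by (rule f''_ge0_imp_convex[OF convex_support_interval d\<phi>]) (use assms(8) in blast)+
  have \<phi>'_mono: "\<phi>' a \<le> \<phi>' b" if "a \<in> ?S" "b \<in> ?S" "a \<le> b" for a b
    using assms(8) d\<phi>(2) support_interval_between[OF that(1,2)]
    by (intro DERIV_nonneg_imp_nondecreasing[OF that(3)]) blast
  have cont_phi: "continuous_on ?S \<phi>"
    using d\<phi>(1) by (meson DERIV_isCont continuous_at_imp_continuous_on)

  define q where "q p = real_of_ereal (quantile ?D p)" for p
  have q: "quantile ?D p = ereal (q p)" "q p \<in> ?S" if "0 < p" "p < 1" for p
    by (rule cdf_quantile[OF D cont that]; simp add: q_def)+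
  have q_mono: "q p \<le> q p'" if "0 < p" "p \<le> p'" "p' < 1" for p p'
    using quantile_mono[OF that(1,2), of ?D] q[of p] q[of p'] that by simp
  have \<phi>q: "quantile ?E p = ereal (\<phi> (q p))" if "0 < p" "p < 1" for p
    using quantile_transform[OF assms(1,2,6) cont mono cont_phi that] q that by blast
  define m where "m = q c"
  have q_sym: "q (1 - \<epsilon>) = 2 * m - q (\<gamma> * \<epsilon>)" if \<epsilon>: "0 < \<epsilon>" "\<epsilon> \<le> N" for \<epsilon>
  proof -
    have "quantile ?D (\<gamma> * \<epsilon>) = 2 * quantile ?D c - quantile ?D (1 - \<epsilon>)"
      using sym \<epsilon> by (simp add: gamma_symmetric_def c_def N_def)
    then show ?thesis
      using q(1)[of "\<gamma> * \<epsilon>"] q(1)[of c] q(1)[of "1 - \<epsilon>"] range[OF \<epsilon>] cN by (simp add: m_def)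
  qed
  have lower: "q (\<gamma> * \<epsilon>) \<in> ?S" "q (\<gamma> * \<epsilon>) \<le> m" and upper: "2 * m - q (\<gamma> * \<epsilon>) \<in> ?S"
    if \<epsilon>: "0 < \<epsilon>" "\<epsilon> \<le> N" for \<epsilon>
    using range[OF \<epsilon>] cN q(2)[of "\<gamma> * \<epsilon>"] q(2)[of "1 - \<epsilon>"] q_sym[OF \<epsilon>] q_mono[of "\<gamma> * \<epsilon>" c]
    by (auto simp: m_def)

  define A where "A \<epsilon> = (\<phi> (q (\<gamma> * \<epsilon>)) + \<phi> (2 * m - q (\<gamma> * \<epsilon>))) / 2" for \<epsilon>
  have QA: "quantile_average ?E \<epsilon> \<gamma> = ereal (A \<epsilon>)" if \<epsilon>: "0 < \<epsilon>" "\<epsilon> \<le> N" for \<epsilon>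
    using \<phi>q[of "\<gamma> * \<epsilon>"] \<phi>q[of "1 - \<epsilon>"] range[OF \<epsilon>] cN q_sym[OF \<epsilon>]
    by (simp add: quantile_average_def A_def)
  have A_anti: "A \<epsilon>\<^sub>2 \<le> A \<epsilon>\<^sub>1" if "0 < \<epsilon>\<^sub>1" "\<epsilon>\<^sub>1 \<le> \<epsilon>\<^sub>2" "\<epsilon>\<^sub>2 \<le> N" for \<epsilon>\<^sub>1 \<epsilon>\<^sub>2
  proof -
    have \<epsilon>\<^sub>1: "\<epsilon>\<^sub>1 \<le> N" and \<epsilon>\<^sub>2: "0 < \<epsilon>\<^sub>2" using that by auto
    have "q (\<gamma> * \<epsilon>\<^sub>1) \<le> q (\<gamma> * \<epsilon>\<^sub>2)"
      using that \<gamma> range[OF \<epsilon>\<^sub>2 that(3)] range[OF that(1) \<epsilon>\<^sub>1] cN by (intro q_mono) auto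
    then show ?thesis
      using convex_on_spread[OF conv lower(1)[OF that(1) \<epsilon>\<^sub>1] upper[OF that(1) \<epsilon>\<^sub>1],
          of "q (\<gamma> * \<epsilon>\<^sub>2)" "2 * m - q (\<gamma> * \<epsilon>\<^sub>2)"]
        lower(2)[OF \<epsilon>\<^sub>2 that(3)] lower(2)[OF that(1) \<epsilon>\<^sub>1]
      by (simp add: A_def)
  qed

  have zero: "ereal (A \<epsilon>) \<le> quantile_average ?E 0 \<gamma>" if \<epsilon>: "0 < \<epsilon>" "\<epsilon> \<le> N" for \<epsilon>
  proof -
    have top: "ereal (\<phi> (q p)) \<le> quantile ?E 1" if "0 < p" "p < 1" for p
      using quantile_mono[of p 1 ?E] \<phi>q[OF that] that by simp
    have "ereal (2 * A \<epsilon>) \<le> quantile ?E 0 + quantile ?E 1"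
    proof (cases "quantile ?E 1")
      case (real r)
      have "ereal (2 * A \<epsilon> - r) \<le> quantile ?E p" if p: "0 < p" "p < \<gamma> * \<epsilon>" for p
      proof -
        \<comment> \<open>the parameter whose lower quantile has level \<open>p\<close>\<close>
        define \<delta> where "\<delta> = p / \<gamma>"
        have \<delta>: "0 < \<delta>" "\<delta> \<le> \<epsilon>" "\<gamma> * \<delta> = p"
          using p \<gamma> by (auto simp: \<delta>_def field_simps)
        then have \<delta>N: "\<delta> \<le> N" using \<epsilon> by simp
        have "\<phi> (2 * m - q p) \<le> r"
          using top[of "1 - \<delta>"] real q_sym[OF \<delta>(1) \<delta>N] range[OF \<delta>(1) \<delta>N] cN \<delta>(3) by simp
        moreover have "2 * A \<epsilon> \<le> \<phi> (q p) + \<phi> (2 * m - q p)"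
          using A_anti[OF \<delta>(1,2) \<epsilon>(2)] by (simp add: A_def[of \<delta>] \<delta>(3))
        ultimately show ?thesis
          using \<phi>q[of p] p range[OF \<epsilon>] cN by simp
      qed
      then have "ereal (2 * A \<epsilon> - r) \<le> quantile ?E 0"
        by (rule quantile_zero_ge[OF E range(1)[OF \<epsilon>]])
      then show ?thesis
        using real by (cases "quantile ?E 0") auto
    next
      case PInf
      \<comment> \<open>This includes the convention \<open>-\<infinity> + \<infinity> = \<infinity>\<close>.\<close>
      then show ?thesis by simp
    next
      case MInf
      then show ?thesis using top[of c] cN by simp
    qed
    then have "ereal (2 * A \<epsilon>) / 2 \<le> (quantile ?E 0 + quantile ?E 1) / 2"
      by (intro ereal_divide_right_mono) auto
    then show ?thesis
      by (simp add: quantile_average_def)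
  qed

  have ordered: "gamma_ordered ?E \<gamma>"
    unfolding gamma_ordered_def N_def[symmetric]
  proof (intro allI impI, elim conjE)
    fix \<epsilon>\<^sub>1 \<epsilon>\<^sub>2 :: real
    assume \<epsilon>: "0 \<le> \<epsilon>\<^sub>1" "\<epsilon>\<^sub>1 \<le> \<epsilon>\<^sub>2" "\<epsilon>\<^sub>2 \<le> N"
    consider "\<epsilon>\<^sub>1 = \<epsilon>\<^sub>2" | "\<epsilon>\<^sub>1 = 0" "0 < \<epsilon>\<^sub>2" | "0 < \<epsilon>\<^sub>1"
      using \<epsilon> by linarith
    then show "quantile_average ?E \<epsilon>\<^sub>2 \<gamma> \<le> quantile_average ?E \<epsilon>\<^sub>1 \<gamma>"
      by cases (use \<epsilon> zero QA A_anti in auto)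
  qed

  have "second_gamma_ordered ?E \<gamma>"
    if two: "has_two_derivs_on q Q' Q'' {0<..c}" and Q'': "\<forall>p\<in>{0<..c}. Q'' p \<le> 0" for Q' Q''
  proof -
    let ?I = "{0<..N}"
    define A' where "A' \<epsilon> =
      \<gamma> / 2 * (Q' (\<gamma> * \<epsilon>) * (\<phi>' (q (\<gamma> * \<epsilon>)) - \<phi>' (2 * m - q (\<gamma> * \<epsilon>))))" for \<epsilon>
    define A'' where "A'' \<epsilon> = \<gamma>\<^sup>2 / 2 *
      (Q'' (\<gamma> * \<epsilon>) * (\<phi>' (q (\<gamma> * \<epsilon>)) - \<phi>' (2 * m - q (\<gamma> * \<epsilon>))) +
       (Q' (\<gamma> * \<epsilon>))\<^sup>2 * (\<phi>'' (q (\<gamma> * \<epsilon>)) + \<phi>'' (2 * m - q (\<gamma> * \<epsilon>))))" for \<epsilon>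
    have image: "(\<lambda>\<epsilon>. \<gamma> * \<epsilon>) ` ?I \<subseteq> {0<..c}"
      using range by auto
    have scale: "((\<lambda>\<epsilon>. f (\<gamma> * \<epsilon>)) has_real_derivative d * \<gamma>) (at \<epsilon> within ?I)"
      if "(f has_real_derivative d) (at (\<gamma> * \<epsilon>) within {0<..c})" for f d \<epsilon>
    proof -
      have "((\<lambda>\<epsilon>. \<gamma> * \<epsilon>) has_real_derivative \<gamma>) (at \<epsilon> within ?I)"
        by (auto intro!: derivative_eq_intros)
      from DERIV_image_chain[OF has_field_derivative_subset[OF that image] this]
      show ?thesis by (simp add: o_def)
    qed
    have *: "(A has_real_derivative A' \<epsilon>) (at \<epsilon> within ?I) \<and>
        (A' has_real_derivative A'' \<epsilon>) (at \<epsilon> within ?I) \<and> 0 \<le> A'' \<epsilon> \<and> A' \<epsilon> \<le> 0"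
      if "\<epsilon> \<in> ?I" for \<epsilon>
    proof -
      have \<epsilon>: "0 < \<epsilon>" "\<epsilon> \<le> N" using that by auto
      define u where "u = q (\<gamma> * \<epsilon>)"
      define v where "v = 2 * m - q (\<gamma> * \<epsilon>)"
      have uS: "u \<in> ?S" and vS: "v \<in> ?S" and "u \<le> v"
        using lower[OF \<epsilon>] upper[OF \<epsilon>] by (auto simp: u_def v_def)
      have in_c: "\<gamma> * \<epsilon> \<in> {0<..c}" using range[OF \<epsilon>] by simp
      then have dq: "(q has_real_derivative Q' (\<gamma> * \<epsilon>)) (at (\<gamma> * \<epsilon>) within {0<..c})"
        and dQ': "(Q' has_real_derivative Q'' (\<gamma> * \<epsilon>)) (at (\<gamma> * \<epsilon>) within {0<..c})"
        using two by (auto simp: has_two_derivs_on_def)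
      have sq: "((\<lambda>\<epsilon>. q (\<gamma> * \<epsilon>)) has_real_derivative Q' (\<gamma> * \<epsilon>) * \<gamma>) (at \<epsilon> within ?I)"
        by (rule scale[OF dq])
      have sv: "((\<lambda>\<epsilon>. 2 * m - q (\<gamma> * \<epsilon>)) has_real_derivative - (Q' (\<gamma> * \<epsilon>) * \<gamma>)) (at \<epsilon> within ?I)"
        by (auto intro!: derivative_eq_intros sq)
      note du = d\<phi>[OF uS, unfolded u_def] and dv = d\<phi>[OF vS, unfolded v_def]
      have "(A has_real_derivative A' \<epsilon>) (at \<epsilon> within ?I)"
        unfolding A_def[abs_def] A'_def
        by (rule DERIV_cong[OF DERIV_cdivide[OF
                DERIV_add[OF DERIV_chain2[OF du(1) sq] DERIV_chain2[OF dv(1) sv]]]])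
          (simp add: field_simps)
      moreover have "(A' has_real_derivative A'' \<epsilon>) (at \<epsilon> within ?I)"
        unfolding A'_def[abs_def] A''_def
        by (rule DERIV_cong[OF DERIV_cmult[OF DERIV_mult[OF scale[OF dQ']
                  DERIV_diff[OF DERIV_chain2[OF du(2) sq] DERIV_chain2[OF dv(2) sv]]]]])
          (simp add: field_simps power2_eq_square)
      moreover have dec: "\<phi>' u - \<phi>' v \<le> 0"
        using \<phi>'_mono[OF uS vS \<open>u \<le> v\<close>] by simp
      moreover have Q'_nonneg: "0 \<le> Q' (\<gamma> * \<epsilon>)"
      proof (rule mono_on_deriv_within_nonneg[OF _ dq in_c])
        show "mono_on {0<..c} q"
          using q_mono cN by (auto intro!: mono_onI)
        show "at (\<gamma> * \<epsilon>) within {0<..c} \<noteq> bot"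
          using in_c cN(1) by (simp add: trivial_limit_within islimpt_Ioc)
      qed
      have "A' \<epsilon> \<le> 0"
        using \<gamma> mult_nonneg_nonpos[OF Q'_nonneg dec]
        by (simp add: A'_def u_def v_def mult_nonneg_nonpos)
      moreover have "0 \<le> A'' \<epsilon>"
      proof -
        have "0 \<le> Q'' (\<gamma> * \<epsilon>) * (\<phi>' u - \<phi>' v)"
          using Q'' in_c dec by (intro mult_nonpos_nonpos) auto
        moreover have "0 \<le> (Q' (\<gamma> * \<epsilon>))\<^sup>2 * (\<phi>'' u + \<phi>'' v)"
          using assms(8) uS vS by simp
        ultimately show ?thesis
          by (simp add: A''_def u_def v_def)
      qed
      ultimately show ?thesis by blast
    qed
    have "has_two_derivs_on (\<lambda>\<epsilon>. real_of_ereal (quantile_average ?E \<epsilon> \<gamma>)) A' A'' ?I"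
      unfolding has_two_derivs_on_def
      using * by (auto intro: has_field_derivative_transform_within[of A _ _ ?I 1] simp: QA)
    then show ?thesis
      unfolding second_gamma_ordered_def N_def[symmetric]
      using ordered * QA by (intro conjI exI[of _ A'] exI[of _ A'']) auto
  qed
  then show ?thesis
    using ordered unfolding q_def c_def by blast
qed

end
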